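(* Let $G$ be a countable residually finite group, equipped with a proper right-invariant metric. Let $\sigma$ be a semi-conjugacy-separating family of finite-index subgroups of $G$. Then $\operatorname{asdim}(G)\le\operatorname{asdim}(\square_\sigma G)$.
   Context: A coarse space is a set $X$ with a collection $\mathcal E$ of subsets of $X\times X$ (entourages) that contains the diagonal and is closed under subsets, finite unions, inverses and compositions. It is connected if $\{(x,y)\}\in\mathcal E$ for all $x,y\in X$. A coarse space $(X,\mathcal E)$ has $\operatorname{asdim}(X)\le n$ if for every $E\in\mathcal E$ there is a cover $\mathcal U$ of $X$ such that $\bigcup_{U\in\mathcal U}U\times U\in\mathcal E$, any $n+2$ distinct members of $\mathcal U$ have empty intersection, and every non-empty $A\subseteq X$ with $A\times A\subseteq E$ is contained in some $U\in\mathcal U$. (For a metric space with entourages the subsets of the sets $\{d\le R\}$: for each $R>0$ there is a uniformly bounded cover of multiplicity at most $n+1$ and Lebesgue number at least $R$.) $\operatorname{asdim}(X)\in\{0,1,2,\dots\}\cup\{\infty\}$ is the least such $n$, or $\infty$ if there is none. A metric on $G$ is proper if its balls are finite; $\operatorname{asdim}(G)$ is that of $G$ with the given metric. Let $\sigma=(G_\alpha)_\alpha$ be a family (repetitions allowed) of finite-index, not necessarily normal, subgroups of $G$. The box space $\square_\sigma G$ is the set $\bigsqcup_\alpha G/G_\alpha$ (left cosets, with $G$ acting by left multiplication) equipped with the smallest connected $G$-invariant coarse structure containing the sets $\Delta_g=\{(x,gx) : x\in\bigsqcup_\alpha G/G_\alpha\}$ for all $g\in G$. The family $\sigma$ is semi-conjugacy-separating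 if for every non-empty finite $F\subset G$ there is $G_\alpha\in\sigma$ with $G_\alpha\cap g^G G_\alpha=\varnothing$ for every $g\in F\setminus\{1\}$, where $g^G$ is the conjugacy class of $g$. *)

theory Defs
  imports "HOL-Analysis.Analysis" "HOL-Algebra.Left_Coset" "HOL-Library.Extended_Nat"
begin

locale coarse_space =
  fixes X :: "'a set" and \<E> :: "('a \<times> 'a) set set"
  assumes entourage_subset: "E \<in> \<E> \<Longrightarrow> E \<subseteq> X \<times> X"
    and diagonal: "Id_on X \<in> \<E>"
    and subset_closed: "E \<in> \<E> \<Longrightarrow> E' \<subseteq> E \<Longrightarrow> E' \<in> \<E>"
    and union_closed: "E \<in> \<E> \<Longrightarrow> E' \<in> \<E> \<Longrightarrow> E \<union> E' \<in> \<E>"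
    and inverse_closed: "E \<in> \<E> \<Longrightarrow> E\<inverse> \<in> \<E>"
    and comp_closed: "E \<in> \<E> \<Longrightarrow> E' \<in> \<E> \<Longrightarrow> E O E' \<in> \<E>"

definition coarse_connected :: "'a set \<Rightarrow> ('a \<times> 'a) set set \<Rightarrow> bool" where
  "coarse_connected X \<E> \<longleftrightarrow> (\<forall>x\<in>X. \<forall>y\<in>X. {(x, y)} \<in> \<E>)"

definition asdim_le :: "'a set \<Rightarrow> ('a \<times> 'a) set set \<Rightarrow> nat \<Rightarrow> bool" where
  "asdim_le X \<E> n \<longleftrightarrow>
     (\<forall>E\<in>\<E>. \<exists>\<U>. \<Union>\<U> = X
        \<and> (\<Union>U\<in>\<U>. U \<times> U) \<in> \<E>
        \<and> (\<forall>\<V>\<subseteq>\<U>. card \<V> = n + 2 \<longrightarrow> \<Inter>\<V> = {})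
        \<and> (\<forall>A\<subseteq>X. A \<noteq> {} \<and> A \<times> A \<subseteq> E \<longrightarrow> (\<exists>U\<in>\<U>. A \<subseteq> U)))"

text \<open>The infimum of the empty set in \<^typ>\<open>enat\<close> is \<open>\<infinity>\<close>.\<close>

definition asdim :: "'a set \<Rightarrow> ('a \<times> 'a) set set \<Rightarrow> enat" where
  "asdim X \<E> = Inf {enat n | n. asdim_le X \<E> n}"

definition metric_entourages :: "'a set \<Rightarrow> ('a \<Rightarrow> 'a \<Rightarrow> real) \<Rightarrow> ('a \<times> 'a) set set" where
  "metric_entourages M d = {E. E \<subseteq> M \<times> M \<and> (\<exists>R. \<forall>(x, y)\<in>E. d x y \<le> R)}"

definition proper_metric_on :: "'a set \<Rightarrow> ('a \<Rightarrow> 'a \<Rightarrow> real) \<Rightarrow> bool" where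
  "proper_metric_on M d \<longleftrightarrow>
     Metric_space M d \<and> (\<forall>x\<in>M. \<forall>r. finite (Metric_space.mcball M d x r))"

definition right_invariant_metric ::
    "('a, 'b) monoid_scheme \<Rightarrow> ('a \<Rightarrow> 'a \<Rightarrow> real) \<Rightarrow> bool" where
  "right_invariant_metric G d \<longleftrightarrow>
     (\<forall>x\<in>carrier G. \<forall>y\<in>carrier G. \<forall>g\<in>carrier G.
        d (x \<otimes>\<^bsub>G\<^esub> g) (y \<otimes>\<^bsub>G\<^esub> g) = d x y)"

definition finite_index_subgroup :: "('a, 'b) monoid_scheme \<Rightarrow> 'a set \<Rightarrow> bool" where
  "finite_index_subgroup G H \<longleftrightarrow> subgroup H G \<and> finite (lcosets\<^bsub>G\<^esub> H)"

definition residually_finite :: "('a, 'b) monoid_scheme \<Rightarrow> bool" where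
  "residually_finite G \<longleftrightarrow>
     (\<forall>g\<in>carrier G - {\<one>\<^bsub>G\<^esub>}. \<exists>N. N \<lhd> G \<and> finite_index_subgroup G N \<and> g \<notin> N)"

definition conjugacy_class :: "('a, 'b) monoid_scheme \<Rightarrow> 'a \<Rightarrow> 'a set" where
  "conjugacy_class G g = {h \<otimes>\<^bsub>G\<^esub> g \<otimes>\<^bsub>G\<^esub> inv\<^bsub>G\<^esub> h | h. h \<in> carrier G}"

definition semi_conjugacy_separating ::
    "('a, 'b) monoid_scheme \<Rightarrow> 'i set \<Rightarrow> ('i \<Rightarrow> 'a set) \<Rightarrow> bool" where
  "semi_conjugacy_separating G I \<sigma> \<longleftrightarrow>
     (\<forall>F. F \<noteq> {} \<and> finite F \<and> F \<subseteq> carrier G \<longrightarrow>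
        (\<exists>\<alpha>\<in>I. \<forall>g\<in>F - {\<one>\<^bsub>G\<^esub>}. \<sigma> \<alpha> \<inter> (conjugacy_class G g <#>\<^bsub>G\<^esub> \<sigma> \<alpha>) = {}))"

text \<open>The point \<open>(\<alpha>, C)\<close> is the coset \<open>C\<close> in the copy of \<open>G/G\<^sub>\<alpha>\<close> indexed by \<open>\<alpha>\<close>.\<close>

definition box_set ::
    "('a, 'b) monoid_scheme \<Rightarrow> 'i set \<Rightarrow> ('i \<Rightarrow> 'a set) \<Rightarrow> ('i \<times> 'a set) set" where
  "box_set G I \<sigma> = (SIGMA \<alpha>:I. lcosets\<^bsub>G\<^esub> (\<sigma> \<alpha>))"

definition box_act ::
    "('a, 'b) monoid_scheme \<Rightarrow> 'a \<Rightarrow> 'i \<times> 'a set \<Rightarrow> 'i \<times> 'a set" where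
  "box_act G g x = (fst x, g <#\<^bsub>G\<^esub> snd x)"

definition box_Delta ::
    "('a, 'b) monoid_scheme \<Rightarrow> 'i set \<Rightarrow> ('i \<Rightarrow> 'a set) \<Rightarrow> 'a
       \<Rightarrow> (('i \<times> 'a set) \<times> ('i \<times> 'a set)) set" where
  "box_Delta G I \<sigma> g = {(x, box_act G g x) | x. x \<in> box_set G I \<sigma>}"

text \<open>
  Invariance of a coarse structure means that the translates of each entourage by single
  group elements are entourages. It does not mean that each entourage lies in an invariant one:
  the union of the translates of \<open>\<Delta>\<^sub>g\<close> is the union of \<open>\<Delta>\<^sub>h\<close> over all conjugates
  \<open>h\<close> of \<open>g\<close>.
\<close>

definition box_invariant ::
    "('a, 'b) monoid_scheme \<Rightarrow> (('i \<times> 'a set) \<times> ('i \<times> 'a set)) set set \<Rightarrow> bool" where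
  "box_invariant G \<E> \<longleftrightarrow>
     (\<forall>g\<in>carrier G. \<forall>E\<in>\<E>. map_prod (box_act G g) (box_act G g) ` E \<in> \<E>)"

definition box_admissible ::
    "('a, 'b) monoid_scheme \<Rightarrow> 'i set \<Rightarrow> ('i \<Rightarrow> 'a set)
       \<Rightarrow> (('i \<times> 'a set) \<times> ('i \<times> 'a set)) set set \<Rightarrow> bool" where
  "box_admissible G I \<sigma> \<E> \<longleftrightarrow>
     coarse_space (box_set G I \<sigma>) \<E>
     \<and> coarse_connected (box_set G I \<sigma>) \<E>
     \<and> box_invariant G \<E>
     \<and> (\<forall>g\<in>carrier G. box_Delta G I \<sigma> g \<in> \<E>)"

definition box_entourages ::
    "('a, 'b) monoid_scheme \<Rightarrow> 'i set \<Rightarrow> ('i \<Rightarrow> 'a set)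
       \<Rightarrow> (('i \<times> 'a set) \<times> ('i \<times> 'a set)) set set" where
  "box_entourages G I \<sigma> = \<Inter>{\<E>. box_admissible G I \<sigma> \<E>}"

lemma coarse_space_metric_entourages:
  assumes "Metric_space M d"
  shows "coarse_space M (metric_entourages M d)"
proof -
  interpret Metric_space M d by fact
  show ?thesis
  proof
    show "Id_on M \<in> metric_entourages M d"
      by (auto simp: metric_entourages_def Id_on_def intro!: exI[of _ 0])
  next
    fix E E' assume "E \<in> metric_entourages M d" "E' \<in> metric_entourages M d"
    then obtain R R' where E: "E \<subseteq> M \<times> M" "\<And>x y. (x, y) \<in> E \<Longrightarrow> d x y \<le> R"
      and E': "E' \<subseteq> M \<times> M" "\<And>x y. (x, y) \<in> E' \<Longrightarrow> d x y \<le> R'"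
      unfolding metric_entourages_def by blast
    have "\<forall>(x, y)\<in>E \<union> E'. d x y \<le> max R R'" using E E' by fastforce
    then show "E \<union> E' \<in> metric_entourages M d"
      using E(1) E'(1) unfolding metric_entourages_def by blast
    have "d x z \<le> R + R'" if "(x, y) \<in> E" "(y, z) \<in> E'" for x y z
      using E E' that triangle[of x y z] by fastforce
    then have "\<forall>(x, z)\<in>E O E'. d x z \<le> R + R'" by auto
    moreover have "E O E' \<subseteq> M \<times> M" using E(1) E'(1) by blast
    ultimately show "E O E' \<in> metric_entourages M d"
      unfolding metric_entourages_def by blast
  next
    fix E assume "E \<in> metric_entourages M d"
    then obtain R where E: "E \<subseteq> M \<times> M" "\<And>x y. (x, y) \<in> E \<Longrightarrow> d x y \<le> R"
      unfolding metric_entourages_def by blast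
    show "E \<subseteq> M \<times> M" by fact
    have "d y x \<le> R" if "(x, y) \<in> E" for x y
      using E(2)[OF that] by (simp add: commute)
    then have "\<forall>(x, y)\<in>E\<inverse>. d x y \<le> R" by blast
    moreover have "E\<inverse> \<subseteq> M \<times> M" using E(1) by blast
    ultimately show "E\<inverse> \<in> metric_entourages M d"
      unfolding metric_entourages_def by blast
    fix E' assume "E' \<subseteq> E"
    then have "E' \<subseteq> M \<times> M" "\<forall>(x, y)\<in>E'. d x y \<le> R" using E by blast+
    then show "E' \<in> metric_entourages M d"
      unfolding metric_entourages_def by blast
  qed
qed

lemma (in group) box_act_in_box_set:
  assumes "\<And>\<alpha>. \<alpha> \<in> I \<Longrightarrow> subgroup (\<sigma> \<alpha>) G" "g \<in> carrier G" "x \<in> box_set G I \<sigma>"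
  shows "box_act G g x \<in> box_set G I \<sigma>"
proof -
  obtain \<alpha> a where x: "x = (\<alpha>, a <#\<^bsub>G\<^esub> \<sigma> \<alpha>)" "\<alpha> \<in> I" "a \<in> carrier G"
    using assms(3) by (auto simp: box_set_def LCOSETS_def)
  have "g <#\<^bsub>G\<^esub> (a <#\<^bsub>G\<^esub> \<sigma> \<alpha>) = (g \<otimes> a) <#\<^bsub>G\<^esub> \<sigma> \<alpha>"
    using lcos_m_assoc[OF subgroup.subset[OF assms(1)[OF x(2)]] assms(2) x(3)] .
  then show ?thesis
    using x assms(2) by (auto simp: box_act_def box_set_def LCOSETS_def)
qed

lemma (in group) box_admissible_box_entourages:
  assumes "\<And>\<alpha>. \<alpha> \<in> I \<Longrightarrow> subgroup (\<sigma> \<alpha>) G"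
  shows "box_admissible G I \<sigma> (box_entourages G I \<sigma>)"
proof -
  let ?X = "box_set G I \<sigma>"
  have act: "box_act G g x \<in> ?X" if "g \<in> carrier G" "x \<in> ?X" for g x
    by (rule box_act_in_box_set) (use assms that in simp_all)
  have "coarse_space ?X (Pow (?X \<times> ?X))"
    by unfold_locales blast+
  moreover have "box_invariant G (Pow (?X \<times> ?X))"
    unfolding box_invariant_def
  proof (intro ballI PowI subsetI)
    fix g E p
    assume "g \<in> carrier G" "E \<in> Pow (?X \<times> ?X)"
      and "p \<in> map_prod (box_act G g) (box_act G g) ` E"
    then show "p \<in> ?X \<times> ?X" using act by force
  qed
  moreover have "\<forall>g\<in>carrier G. box_Delta G I \<sigma> g \<in> Pow (?X \<times> ?X)"
    using act unfolding box_Delta_def by blast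
  ultimately have top: "box_admissible G I \<sigma> (Pow (?X \<times> ?X))"
    unfolding box_admissible_def coarse_connected_def by blast
  have cs: "coarse_space ?X \<E>" if "box_admissible G I \<sigma> \<E>" for \<E>
    using that unfolding box_admissible_def by blast
  have "coarse_space ?X (box_entourages G I \<sigma>)"
  proof
    show "E \<subseteq> ?X \<times> ?X" if "E \<in> box_entourages G I \<sigma>" for E
      using that top unfolding box_entourages_def by blast
    show "Id_on ?X \<in> box_entourages G I \<sigma>"
      unfolding box_entourages_def using coarse_space.diagonal[OF cs] by blast
    show "E' \<in> box_entourages G I \<sigma>" if "E \<in> box_entourages G I \<sigma>" "E' \<subseteq> E" for E E'
      using that coarse_space.subset_closed[OF cs] unfolding box_entourages_def by blast
    show "E \<union> E' \<in> box_entourages G I \<sigma>"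
      if "E \<in> box_entourages G I \<sigma>" "E' \<in> box_entourages G I \<sigma>" for E E'
      using that coarse_space.union_closed[OF cs] unfolding box_entourages_def by blast
    show "E\<inverse> \<in> box_entourages G I \<sigma>" if "E \<in> box_entourages G I \<sigma>" for E
      using that coarse_space.inverse_closed[OF cs] unfolding box_entourages_def by blast
    show "E O E' \<in> box_entourages G I \<sigma>"
      if "E \<in> box_entourages G I \<sigma>" "E' \<in> box_entourages G I \<sigma>" for E E'
      using that coarse_space.comp_closed[OF cs] unfolding box_entourages_def by blast
  qed
  then show ?thesis
    unfolding box_admissible_def box_entourages_def coarse_connected_def box_invariant_def
    by blast
qed

end

theory Submission
  imports Defs "HOL-Complex_Analysis.Great_Picard"
begin

text \<open>
  Every entourage of the box space lies in \<open>\<Union>g\<in>F. \<Delta>\<^sub>g\<close> together with \<open>K \<times> K\<close> for finite \<open>F\<close> and \<open>K\<close>,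
  since these sets already form an admissible coarse structure. If \<open>g\<close> fixes a coset of \<open>G\<^sub>\<alpha>\<close>,
  then a conjugate of \<open>g\<close> lies in \<open>G\<^sub>\<alpha>\<close>; so semi-conjugacy separation provides components
  on which a prescribed finite set of non-trivial elements has no fixed points. When \<open>G\<close> is
  infinite such a component can be made too large to meet \<open>K\<close>. Pulling a cover of the box space
  back along an orbit map \<open>g \<mapsto> g x\<close> on such a component gives, for each finite \<open>T \<subseteq> G\<close>, a
  cover of \<open>T\<close> with the required multiplicity and Lebesgue number, whose members are bounded
  independently of \<open>T\<close>. As bounded sets are finite, a diagonal subsequence of the covers of the
  balls \<open>T\<close> converges to a cover of \<open>G\<close>. A finite \<open>G\<close> is covered by itself.
\<close>

section \<open>Limits of sequences of covers\<close>

text \<open>Membership in \<open>\<V> k\<close> is encoded by indicator functions, which are bounded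
  by 1. The diagonal argument in \<open>function_convergent_subsequence\<close> makes them converge
  pointwise on the countable set \<open>C\<close>, and a convergent sequence of zeros and ones is
  eventually constant.\<close>

lemma subfamily_limit_exists:
  fixes \<V> :: "nat \<Rightarrow> 'a set" and C :: "'a set"
  assumes "countable C"
  obtains r :: "nat \<Rightarrow> nat" where "strict_mono r"
    and "\<And>A. A \<in> C \<Longrightarrow> (\<forall>\<^sub>F k in sequentially. A \<in> \<V> (r k)) \<or> (\<forall>\<^sub>F k in sequentially. A \<notin> \<V> (r k))"
proof -
  define f :: "nat \<Rightarrow> 'a \<Rightarrow> real" where "f k A = indicator (\<V> k) A" for k A
  have bound: "norm (f k A) \<le> 1" for k A
    by (simp add: f_def indicator_def)
  obtain r where r: "strict_mono r"
    and conv: "\<And>A. A \<in> C \<Longrightarrow> \<exists>l. (\<lambda>k. f (r k) A) \<longlonglongrightarrow> l"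
    using function_convergent_subsequence[OF assms, of f 1] bound by blast
  show thesis
  proof (rule that[OF r])
    fix A assume "A \<in> C"
    then obtain l where l: "(\<lambda>k. f (r k) A) \<longlonglongrightarrow> l" using conv by blast
    show "(\<forall>\<^sub>F k in sequentially. A \<in> \<V> (r k)) \<or> (\<forall>\<^sub>F k in sequentially. A \<notin> \<V> (r k))"
    \<comment> \<open>Any threshold strictly between 0 and 1 would do: eventually above it the
      indicator is 1, and a limit below 1 forces it to be 0 eventually.\<close>
    proof (cases "l > 1/2")
      case True
      from order_tendstoD(1)[OF l True] have "\<forall>\<^sub>F k in sequentially. A \<in> \<V> (r k)"
        by eventually_elim (rule ccontr, simp add: f_def)
      then show ?thesis ..
    next
      case False
      then have "l < 1" by simp
      from order_tendstoD(2)[OF l this] have "\<forall>\<^sub>F k in sequentially. A \<notin> \<V> (r k)"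
        by eventually_elim (auto simp: f_def)
      then show ?thesis ..
    qed
  qed
qed

text \<open>The limit \<open>\<U>\<close> consists of the sets that eventually belong to the covers
  of a subsequence. A finite subfamily of \<open>\<U>\<close> lies in a single
  \<open>\<V> k\<close>, so multiplicity passes to the limit. The Lebesgue property passes because
  \<open>N x\<close> leaves only finitely many candidates for a member around
  \<open>x\<close>.\<close>

lemma limit_cover_exists:
  fixes \<V> :: "nat \<Rightarrow> 'a set set" and N :: "'a \<Rightarrow> 'a set"
  assumes M: "countable M"
    and sub: "\<And>k V. V \<in> \<V> k \<Longrightarrow> V \<subseteq> M"
    and N: "\<And>x. x \<in> M \<Longrightarrow> finite (N x)"
    and loc: "\<And>k V x. V \<in> \<V> k \<Longrightarrow> x \<in> V \<Longrightarrow> V \<subseteq> N x"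
    and mult: "\<And>k \<W>. \<W> \<subseteq> \<V> k \<Longrightarrow> card \<W> = Suc m \<Longrightarrow> \<Inter>\<W> = {}"
    and leb: "\<And>A. P A \<Longrightarrow> A \<noteq> {} \<and> (\<forall>\<^sub>F k in sequentially. \<exists>V\<in>\<V> k. A \<subseteq> V)"
  obtains \<U> where "\<And>U. U \<in> \<U> \<Longrightarrow> \<exists>k. U \<in> \<V> k"
    and "\<And>\<W>. \<W> \<subseteq> \<U> \<Longrightarrow> card \<W> = Suc m \<Longrightarrow> \<Inter>\<W> = {}"
    and "\<And>A. P A \<Longrightarrow> \<exists>U\<in>\<U>. A \<subseteq> U"
proof -
  define C where "C = {A. finite A \<and> A \<subseteq> M}"
  have "countable C"
    unfolding C_def by (rule countable_Collect_finite_subset[OF M])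
  then obtain r where r: "strict_mono r"
    and dich: "\<And>A. A \<in> C \<Longrightarrow> (\<forall>\<^sub>F k in sequentially. A \<in> \<V> (r k)) \<or> (\<forall>\<^sub>F k in sequentially. A \<notin> \<V> (r k))"
    using subfamily_limit_exists[of C \<V>] by blast
  define \<U> where "\<U> = {A. \<forall>\<^sub>F k in sequentially. A \<in> \<V> (r k)}"
  show thesis
  proof (rule that[of \<U>])
    show "\<exists>k. U \<in> \<V> k" if "U \<in> \<U>" for U
      using that eventually_happens'[OF sequentially_bot] unfolding \<U>_def by blast
  next
    fix \<W> assume W: "\<W> \<subseteq> \<U>" "card \<W> = Suc m"
    \<comment> \<open>An infinite set has \<open>card\<close> 0, which is not
      \<open>Suc m\<close>.\<close>
    then have "finite \<W>" using card.infinite by fastforce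
    then have "\<forall>\<^sub>F k in sequentially. \<forall>A\<in>\<W>. A \<in> \<V> (r k)"
      using W(1) by (intro eventually_ball_finite) (auto simp: \<U>_def)
    then obtain k where "\<W> \<subseteq> \<V> (r k)"
      using eventually_happens'[OF sequentially_bot] by blast
    then show "\<Inter>\<W> = {}" using mult W(2) by blast
  next
    fix A assume "P A"
    then obtain x where x: "x \<in> A" and ev: "\<forall>\<^sub>F k in sequentially. \<exists>V\<in>\<V> k. A \<subseteq> V"
      using leb by blast
    have ev: "\<forall>\<^sub>F k in sequentially. \<exists>V\<in>\<V> (r k). A \<subseteq> V"
      using eventually_subseq[OF r ev] .
    then have "x \<in> M"
      using eventually_happens'[OF sequentially_bot] x sub by blast
    \<comment> \<open>The finite pool of candidates. If each were eventually absent, then all would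
      be absent at once from some index on, although \<open>A\<close> eventually always has a member
      around it.\<close>
    define D where "D = {V. V \<subseteq> N x \<and> V \<subseteq> M \<and> A \<subseteq> V}"
    have finD: "finite D"
      by (rule finite_subset[of _ "Pow (N x)"]) (auto simp: D_def N \<open>x \<in> M\<close>)
    have DC: "D \<subseteq> C"
      using finite_subset N[OF \<open>x \<in> M\<close>] unfolding D_def C_def by blast
    show "\<exists>U\<in>\<U>. A \<subseteq> U"
    proof (rule ccontr)
      assume neg: "\<not> (\<exists>U\<in>\<U>. A \<subseteq> U)"
      have "\<forall>\<^sub>F k in sequentially. V \<notin> \<V> (r k)" if "V \<in> D" for V
        using dich[of V] that DC neg unfolding \<U>_def D_def by blast
      then have "\<forall>\<^sub>F k in sequentially. \<forall>V\<in>D. V \<notin> \<V> (r k)"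
        using finD by (intro eventually_ball_finite) auto
      with ev have "\<forall>\<^sub>F k in sequentially. False"
      proof eventually_elim
        case (elim k)
        then obtain V where V: "V \<in> \<V> (r k)" "A \<subseteq> V" by blast
        then have "V \<in> D" using loc[OF V(1)] sub[OF V(1)] x unfolding D_def by blast
        with elim V show False by blast
      qed
      then show False by simp
    qed
  qed
qed

section \<open>The action of the group on the box space\<close>

context group
begin

lemma box_act_closed:
  assumes "\<forall>\<alpha>\<in>I. subgroup (\<sigma> \<alpha>) G" "x \<in> box_set G I \<sigma>" "g \<in> carrier G"
  shows "box_act G g x \<in> box_set G I \<sigma>"
  using assms by (intro box_act_in_box_set) simp_all

lemma box_act_one:
  assumes "\<forall>\<alpha>\<in>I. subgroup (\<sigma> \<alpha>) G" "x \<in> box_set G I \<sigma>"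
  shows "box_act G \<one> x = x"
proof -
  obtain \<alpha> a where x: "x = (\<alpha>, a <# \<sigma> \<alpha>)" "\<alpha> \<in> I" "a \<in> carrier G"
    using assms(2) by (auto simp: box_set_def LCOSETS_def)
  show ?thesis
    using x lcos_m_assoc[OF subgroup.subset[OF bspec[OF assms(1) x(2)]] one_closed x(3)]
    by (simp add: box_act_def)
qed

lemma box_act_mult:
  assumes "\<forall>\<alpha>\<in>I. subgroup (\<sigma> \<alpha>) G" "x \<in> box_set G I \<sigma>"
    and g: "g \<in> carrier G" and h: "h \<in> carrier G"
  shows "box_act G g (box_act G h x) = box_act G (g \<otimes> h) x"
proof -
  obtain \<alpha> a where x: "x = (\<alpha>, a <# \<sigma> \<alpha>)" "\<alpha> \<in> I" "a \<in> carrier G"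
    using assms(2) by (auto simp: box_set_def LCOSETS_def)
  have s: "\<sigma> \<alpha> \<subseteq> carrier G" using subgroup.subset[OF bspec[OF assms(1) x(2)]] .
  show ?thesis
    using x g h by (simp add: box_act_def lcos_m_assoc[OF s] m_assoc)
qed

lemma box_act_inv_cancel:
  assumes "\<forall>\<alpha>\<in>I. subgroup (\<sigma> \<alpha>) G" "x \<in> box_set G I \<sigma>" "g \<in> carrier G"
  shows "box_act G (inv g) (box_act G g x) = x"
  using assms by (simp add: box_act_mult[OF assms(1)] box_act_one[OF assms(1)])

section \<open>An explicit bound for the box space entourages\<close>

text \<open>The squares \<open>K \<times> K\<close> accommodate the singletons that connectedness
  requires, and \<open>F\<close> lists the group elements that move points elsewhere.\<close>

definition box_finitely_controlled ::
    "'i set \<Rightarrow> ('i \<Rightarrow> 'a set) \<Rightarrow> (('i \<times> 'a set) \<times> ('i \<times> 'a set)) set set" where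
  "box_finitely_controlled I \<sigma> =
     {E. \<exists>F K. finite F \<and> F \<subseteq> carrier G \<and> finite K \<and> K \<subseteq> box_set G I \<sigma>
              \<and> E \<subseteq> (\<Union>g\<in>F. box_Delta G I \<sigma> g) \<union> K \<times> K}"

lemma box_finitely_controlledI:
  assumes "finite F" "F \<subseteq> carrier G" "finite K" "K \<subseteq> box_set G I \<sigma>"
    and "\<And>x y. (x, y) \<in> E \<Longrightarrow>
           x \<in> box_set G I \<sigma> \<and> (\<exists>g\<in>F. y = box_act G g x) \<or> x \<in> K \<and> y \<in> K"
  shows "E \<in> box_finitely_controlled I \<sigma>"
proof -
  have "E \<subseteq> (\<Union>g\<in>F. box_Delta G I \<sigma> g) \<union> K \<times> K"
  proof (rule subrelI)
    fix x y assume "(x, y) \<in> E"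
    from assms(5)[OF this] show "(x, y) \<in> (\<Union>g\<in>F. box_Delta G I \<sigma> g) \<union> K \<times> K"
      unfolding box_Delta_def by blast
  qed
  then show ?thesis using assms(1-4) unfolding box_finitely_controlled_def by blast
qed

lemma box_finitely_controlledE:
  assumes "E \<in> box_finitely_controlled I \<sigma>"
  obtains F K where "finite F" "F \<subseteq> carrier G" "finite K" "K \<subseteq> box_set G I \<sigma>"
    and "\<And>x y. (x, y) \<in> E \<Longrightarrow>
           x \<in> box_set G I \<sigma> \<and> (\<exists>g\<in>F. y = box_act G g x) \<or> x \<in> K \<and> y \<in> K"
proof -
  obtain F K where FK: "finite F" "F \<subseteq> carrier G" "finite K" "K \<subseteq> box_set G I \<sigma>"
    and E: "E \<subseteq> (\<Union>g\<in>F. box_Delta G I \<sigma> g) \<union> K \<times> K"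
    using assms unfolding box_finitely_controlled_def by blast
  show thesis
  proof (rule that[OF FK])
    fix x y assume "(x, y) \<in> E"
    then have "(x, y) \<in> (\<Union>g\<in>F. box_Delta G I \<sigma> g) \<union> K \<times> K" using E by blast
    then show "x \<in> box_set G I \<sigma> \<and> (\<exists>g\<in>F. y = box_act G g x) \<or> x \<in> K \<and> y \<in> K"
      unfolding box_Delta_def by blast
  qed
qed

lemma coarse_space_box_finitely_controlled:
  assumes sub: "\<forall>\<alpha>\<in>I. subgroup (\<sigma> \<alpha>) G"
  shows "coarse_space (box_set G I \<sigma>) (box_finitely_controlled I \<sigma>)"
proof -
  let ?X = "box_set G I \<sigma>"
  note act = box_act_closed[OF sub]
  show ?thesis
  proof
    fix E assume "E \<in> box_finitely_controlled I \<sigma>"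
    then obtain F K where F: "finite F" "F \<subseteq> carrier G" and K: "finite K" "K \<subseteq> ?X"
      and E: "\<And>x y. (x, y) \<in> E \<Longrightarrow> x \<in> ?X \<and> (\<exists>g\<in>F. y = box_act G g x) \<or> x \<in> K \<and> y \<in> K"
      by (rule box_finitely_controlledE) blast
    show "E \<subseteq> ?X \<times> ?X"
    proof (rule subrelI)
      fix x y assume "(x, y) \<in> E"
      from E[OF this] show "(x, y) \<in> ?X \<times> ?X" using F(2) K(2) act by blast
    qed
    show "E' \<in> box_finitely_controlled I \<sigma>" if "E' \<subseteq> E" for E'
      using that E by (intro box_finitely_controlledI[OF F K]) blast
    show "E\<inverse> \<in> box_finitely_controlled I \<sigma>"
    proof (rule box_finitely_controlledI)
      show "finite (m_inv G ` F)" "m_inv G ` F \<subseteq> carrier G" using F by auto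
      fix y x assume "(y, x) \<in> E\<inverse>"
      then have "(x, y) \<in> E" by simp
      from E[OF this] show "y \<in> ?X \<and> (\<exists>g\<in>m_inv G ` F. x = box_act G g y) \<or> y \<in> K \<and> x \<in> K"
      proof
        assume "x \<in> ?X \<and> (\<exists>g\<in>F. y = box_act G g x)"
        then obtain g where "x \<in> ?X" "g \<in> F" "y = box_act G g x" by blast
        then show ?thesis
          using F(2) act box_act_inv_cancel[OF sub, of x g] by (metis imageI subsetD)
      qed blast
    qed (use K in auto)
    fix E' assume "E' \<in> box_finitely_controlled I \<sigma>"
    then obtain F' K' where F': "finite F'" "F' \<subseteq> carrier G" and K': "finite K'" "K' \<subseteq> ?X"
      and E': "\<And>x y. (x, y) \<in> E' \<Longrightarrow> x \<in> ?X \<and> (\<exists>g\<in>F'. y = box_act G g x) \<or> x \<in> K' \<and> y \<in> K'"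
      by (rule box_finitely_controlledE) blast
    show "E \<union> E' \<in> box_finitely_controlled I \<sigma>"
      using F F' K K' E E' by (intro box_finitely_controlledI[of "F \<union> F'" "K \<union> K'"]) blast+
    \<comment> \<open>\<open>O\<close> applies \<open>E\<close> first, hence the order
      \<open>h \<otimes> g\<close>. In \<open>?K\<close> the translates handle mixed compositions:
      entering \<open>K'\<close> after a step \<open>g\<close> means starting in
      \<open>inv g\<close> applied to \<open>K'\<close>, and a step after \<open>K\<close> ends in a
      translate of \<open>K\<close>.\<close>
    let ?F = "(\<lambda>(g, h). h \<otimes> g) ` (F \<times> F')"
    let ?K = "K \<union> K' \<union> (\<Union>g\<in>F. box_act G (inv g) ` K') \<union> (\<Union>g\<in>F'. box_act G g ` K)"
    show "E O E' \<in> box_finitely_controlled I \<sigma>"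
    proof (rule box_finitely_controlledI)
      show "finite ?F" "finite ?K" using F F' K K' by auto
      show "?F \<subseteq> carrier G" using F F' by auto
      show "?K \<subseteq> ?X"
        by (intro Un_least UN_least image_subsetI act inv_closed) (use F(2) F'(2) K(2) K'(2) in blast)+
      fix x z assume "(x, z) \<in> E O E'"
      then obtain y where xy: "(x, y) \<in> E" and yz: "(y, z) \<in> E'" by blast
      from E[OF xy] show "x \<in> ?X \<and> (\<exists>g\<in>?F. z = box_act G g x) \<or> x \<in> ?K \<and> z \<in> ?K"
      proof
        assume "x \<in> ?X \<and> (\<exists>g\<in>F. y = box_act G g x)"
        then obtain g where g: "x \<in> ?X" "g \<in> F" "y = box_act G g x" by blast
        from E'[OF yz] show ?thesis
        proof
          assume "y \<in> ?X \<and> (\<exists>h\<in>F'. z = box_act G h y)"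
          then obtain h where h: "h \<in> F'" "z = box_act G h y" by blast
          have "z = box_act G (h \<otimes> g) x"
            using g h F(2) F'(2) box_act_mult[OF sub, of x h g] by auto
          then show ?thesis using g h by force
        next
          assume yz: "y \<in> K' \<and> z \<in> K'"
          have "x = box_act G (inv g) y"
            using g F(2) box_act_inv_cancel[OF sub, of x g] by auto
          then show ?thesis using g yz by blast
        qed
      next
        assume xy: "x \<in> K \<and> y \<in> K"
        from E'[OF yz] show ?thesis
        proof
          assume "y \<in> ?X \<and> (\<exists>h\<in>F'. z = box_act G h y)"
          then show ?thesis using xy by blast
        qed (use xy in blast)
      qed
    qed
  next
    show "Id_on ?X \<in> box_finitely_controlled I \<sigma>"
      using box_act_one[OF sub] by (intro box_finitely_controlledI[of "{\<one>}" "{}"]) fastforce+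
  qed
qed

text \<open>For invariance, translating the pair of \<open>x\<close> and \<open>h x\<close> by
  \<open>g\<close> replaces the label \<open>h\<close> by its conjugate under \<open>g\<close>. Only
  one \<open>g\<close> acts at a time, so the set of labels stays finite.\<close>

lemma box_admissible_box_finitely_controlled:
  assumes sub: "\<forall>\<alpha>\<in>I. subgroup (\<sigma> \<alpha>) G"
  shows "box_admissible G I \<sigma> (box_finitely_controlled I \<sigma>)"
  unfolding box_admissible_def
proof (intro conjI ballI)
  let ?X = "box_set G I \<sigma>"
  note act = box_act_closed[OF sub]
  show "coarse_space ?X (box_finitely_controlled I \<sigma>)"
    using sub by (rule coarse_space_box_finitely_controlled)
  show "coarse_connected ?X (box_finitely_controlled I \<sigma>)"
    unfolding coarse_connected_def
  proof (intro ballI)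
    fix x y assume "x \<in> ?X" "y \<in> ?X"
    then show "{(x, y)} \<in> box_finitely_controlled I \<sigma>"
      by (intro box_finitely_controlledI[of "{}" "{x, y}"]) auto
  qed
  show "box_Delta G I \<sigma> g \<in> box_finitely_controlled I \<sigma>" if "g \<in> carrier G" for g
    using that by (intro box_finitely_controlledI[of "{g}" "{}"]) (auto simp: box_Delta_def)
  show "box_invariant G (box_finitely_controlled I \<sigma>)"
    unfolding box_invariant_def
  proof (intro ballI)
    fix g E assume g: "g \<in> carrier G" and "E \<in> box_finitely_controlled I \<sigma>"
    then obtain F K where F: "finite F" "F \<subseteq> carrier G" and K: "finite K" "K \<subseteq> ?X"
      and E: "\<And>x y. (x, y) \<in> E \<Longrightarrow> x \<in> ?X \<and> (\<exists>g\<in>F. y = box_act G g x) \<or> x \<in> K \<and> y \<in> K"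
      by (elim box_finitely_controlledE) blast
    let ?F = "(\<lambda>h. g \<otimes> h \<otimes> inv g) ` F"
    show "map_prod (box_act G g) (box_act G g) ` E \<in> box_finitely_controlled I \<sigma>"
    proof (rule box_finitely_controlledI[of ?F "box_act G g ` K"])
      show "finite ?F" "finite (box_act G g ` K)" using F K by simp_all
      show "?F \<subseteq> carrier G" using F(2) g by auto
      show "box_act G g ` K \<subseteq> ?X" using K(2) g act by blast
      fix x' y' assume "(x', y') \<in> map_prod (box_act G g) (box_act G g) ` E"
      then obtain x y where xy: "(x, y) \<in> E" "x' = box_act G g x" "y' = box_act G g y" by auto
      from E[OF xy(1)]
      show "x' \<in> ?X \<and> (\<exists>h\<in>?F. y' = box_act G h x') \<or> x' \<in> box_act G g ` K \<and> y' \<in> box_act G g ` K"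
      proof
        assume "x \<in> ?X \<and> (\<exists>h\<in>F. y = box_act G h x)"
        then obtain h where h: "x \<in> ?X" "h \<in> F" "y = box_act G h x" by blast
        have hc: "h \<in> carrier G" using h F by blast
        have "y' = box_act G (g \<otimes> h \<otimes> inv g) x'"
          using h hc g xy by (simp add: box_act_mult[OF sub] m_assoc)
        then show ?thesis using h xy act g by blast
      qed (use xy in blast)
    qed
  qed
qed

text \<open>The box structure is the intersection of all admissible ones, so it is contained in the
  explicit one.\<close>

lemma box_entourage_controlled:
  assumes sub: "\<forall>\<alpha>\<in>I. subgroup (\<sigma> \<alpha>) G" and "E \<in> box_entourages G I \<sigma>"
  obtains F K where "finite F" "F \<subseteq> carrier G" "finite K" "K \<subseteq> box_set G I \<sigma>"
    and "\<And>x y. (x, y) \<in> E \<Longrightarrow>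
           x \<in> box_set G I \<sigma> \<and> (\<exists>g\<in>F. y = box_act G g x) \<or> x \<in> K \<and> y \<in> K"
proof -
  have "E \<in> box_finitely_controlled I \<sigma>"
    using assms(2) box_admissible_box_finitely_controlled[OF sub]
    unfolding box_entourages_def by blast
  then show thesis using that by (rule box_finitely_controlledE)
qed

lemma box_Delta_UN_entourage:
  assumes sub: "\<forall>\<alpha>\<in>I. subgroup (\<sigma> \<alpha>) G" and "finite B" "B \<subseteq> carrier G"
  shows "(\<Union>g\<in>B. box_Delta G I \<sigma> g) \<in> box_entourages G I \<sigma>"
proof -
  have adm: "box_admissible G I \<sigma> (box_entourages G I \<sigma>)"
    using sub by (intro box_admissible_box_entourages) simp
  then interpret coarse_space "box_set G I \<sigma>" "box_entourages G I \<sigma>"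
    by (simp add: box_admissible_def)
  show ?thesis using assms(2,3)
  proof (induction B rule: finite_induct)
    case empty
    show ?case using subset_closed[OF diagonal, of "{}"] by simp
  next
    case (insert g B)
    then show ?case using adm union_closed unfolding box_admissible_def by simp
  qed
qed

section \<open>Points with prescribed trivial stabilizer elements\<close>

text \<open>If \<open>g\<close> fixes the coset of \<open>a\<close>, then
  \<open>h = inv a \<otimes> g \<otimes> a\<close> lies in \<open>H\<close>. Being a conjugate of
  \<open>g\<close>, it also lies in the product set, as \<open>h \<otimes> \<one>\<close>.\<close>

lemma separated_acts_freely:
  assumes H: "subgroup H G" and g: "g \<in> carrier G" and C: "C \<in> lcosets H"
    and sep: "H \<inter> (conjugacy_class G g <#> H) = {}"
  shows "g <# C \<noteq> C"
proof
  assume eq: "g <# C = C"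
  obtain a where a: "a \<in> carrier G" "C = a <# H" using C by (auto simp: LCOSETS_def)
  have Hs: "H \<subseteq> carrier G" using subgroup.subset[OF H] .
  have "g \<otimes> a \<in> (g \<otimes> a) <# H"
    using g a subgroup.one_closed[OF H] by (force simp: l_coset_def)
  also have "\<dots> = a <# H" using eq a g lcos_m_assoc[OF Hs g a(1)] by simp
  finally obtain h where h: "h \<in> H" "g \<otimes> a = a \<otimes> h" by (auto simp: l_coset_def)
  have hc: "h \<in> carrier G" using h Hs by blast
  have "h = inv a \<otimes> g \<otimes> inv (inv a)"
    using h hc a g by (metis inv_closed inv_inv inv_solve_left m_assoc m_closed)
  then have "h \<in> conjugacy_class G g"
    using a unfolding conjugacy_class_def by blast
  then have "h \<in> conjugacy_class G g <#> H"
    using hc subgroup.one_closed[OF H] unfolding set_mult_def by force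
  with sep h show False by blast
qed

text \<open>Separation does not control which component it yields. To avoid \<open>J\<close>, the
  tested set is enlarged so that the orbit of \<open>x\<close> has more points than all components
  over \<open>J\<close> together.\<close>

lemma free_point_exists:
  assumes fin: "\<forall>\<alpha>\<in>I. finite_index_subgroup G (\<sigma> \<alpha>)"
    and sep: "semi_conjugacy_separating G I \<sigma>"
    and inf: "infinite (carrier G)"
    and S: "finite S" "S \<subseteq> carrier G" and J: "finite J"
  obtains x where "x \<in> box_set G I \<sigma>" "fst x \<notin> J"
    and "\<And>g. g \<in> S \<Longrightarrow> box_act G g x = x \<Longrightarrow> g = \<one>"
proof -
  let ?X = "box_set G I \<sigma>"
  have sub: "\<forall>\<alpha>\<in>I. subgroup (\<sigma> \<alpha>) G"
    using fin by (simp add: finite_index_subgroup_def)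
  note act = box_act_closed[OF sub]
  define Y where "Y = (SIGMA \<alpha>:I \<inter> J. lcosets (\<sigma> \<alpha>))"
  have finY: "finite Y"
    unfolding Y_def using J fin by (intro finite_SigmaI) (auto simp: finite_index_subgroup_def)
  obtain P where P: "finite P" "P \<subseteq> carrier G" "card P = Suc (card Y)"
    using infinite_arbitrarily_large[OF inf] by blast
  \<comment> \<open>The quotients make \<open>p \<mapsto> p x\<close> injective on \<open>P\<close>;
    the identity makes the set non-empty, as the definition of separation demands.\<close>
  define S' where "S' = insert \<one> (S \<union> (\<lambda>(p, q). inv p \<otimes> q) ` (P \<times> P))"
  have S': "finite S'" "S' \<subseteq> carrier G" "S' \<noteq> {}" using S P by (auto simp: S'_def)
  then have "\<exists>\<alpha>\<in>I. \<forall>g\<in>S' - {\<one>}. \<sigma> \<alpha> \<inter> (conjugacy_class G g <#> \<sigma> \<alpha>) = {}"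
    by (intro sep[unfolded semi_conjugacy_separating_def, rule_format] conjI)
  then obtain \<alpha> where \<alpha>: "\<alpha> \<in> I"
    and free: "\<And>g. g \<in> S' - {\<one>} \<Longrightarrow> \<sigma> \<alpha> \<inter> (conjugacy_class G g <#> \<sigma> \<alpha>) = {}"
    by blast
  define x where "x = (\<alpha>, \<one> <# \<sigma> \<alpha>)"
  have x: "x \<in> ?X" using \<alpha> by (auto simp: x_def box_set_def LCOSETS_def)
  have stab: "g = \<one>" if "g \<in> S'" "box_act G g x = x" for g
  proof (rule ccontr)
    assume "g \<noteq> \<one>"
    then have "g <# snd x \<noteq> snd x"
      using x that(1) S'(2) free by (intro separated_acts_freely[OF bspec[OF sub \<alpha>]]) (auto simp: x_def box_set_def)
    then show False using that(2) by (metis box_act_def snd_conv)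
  qed
  show thesis
  proof (rule that[OF x])
    show "fst x \<notin> J"
    proof
      assume "fst x \<in> J"
      then have "box_act G p x \<in> Y" if "p \<in> P" for p
        using act[OF x, of p] that P(2) by (auto simp: Y_def box_set_def box_act_def x_def)
      moreover have "inj_on (\<lambda>p. box_act G p x) P"
      proof (rule inj_onI)
        fix p q assume pq: "p \<in> P" "q \<in> P" "box_act G p x = box_act G q x"
        then have c: "p \<in> carrier G" "q \<in> carrier G" using P by auto
        have "box_act G (inv p \<otimes> q) x = box_act G (inv p) (box_act G q x)"
          using c x by (simp add: box_act_mult[OF sub])
        also have "\<dots> = x"
          using box_act_inv_cancel[OF sub x c(1)] pq(3) by simp
        finally have "inv p \<otimes> q = \<one>"
          using pq by (intro stab) (auto simp: S'_def)
        then show "p = q" using c by (metis inv_equality inv_inv inv_closed)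
      qed
      ultimately have "card P \<le> card Y" using finY by (intro card_inj_on_le) auto
      then show False using P(3) by simp
    qed
    show "g = \<one>" if "g \<in> S" "box_act G g x = x" for g
      using that by (intro stab) (auto simp: S'_def)
  qed
qed

section \<open>Pulling box space covers back to finite subsets of the group\<close>

text \<open>Size is measured by the displacement \<open>h \<otimes> inv g\<close>, which is
  invariant under right translation and is the label of the pair of \<open>g x\<close> and
  \<open>h x\<close> in the box space. \<open>F\<close> bounds the members and \<open>B\<close> is
  the Lebesgue scale.\<close>

definition controlled_cover ::
    "'a set \<Rightarrow> 'a set \<Rightarrow> nat \<Rightarrow> 'a set \<Rightarrow> 'a set set \<Rightarrow> bool" where
  "controlled_cover F B n T \<V> \<longleftrightarrow>
     (\<forall>V\<in>\<V>. V \<subseteq> T \<and> (\<forall>g\<in>V. \<forall>h\<in>V. h \<otimes> inv g \<in> F))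
     \<and> (\<forall>\<W>\<subseteq>\<V>. card \<W> = n + 2 \<longrightarrow> \<Inter>\<W> = {})
     \<and> (\<forall>A\<subseteq>T. A \<noteq> {} \<and> (\<forall>g\<in>A. \<forall>h\<in>A. h \<otimes> inv g \<in> B) \<longrightarrow> (\<exists>V\<in>\<V>. A \<subseteq> V))"

text \<open>\<open>F\<close> is read off from one cover of the box space, before \<open>T\<close> is
  given; only the base point \<open>x\<close> depends on \<open>T\<close>. This uniformity is what
  the limit argument needs.\<close>

lemma finite_set_cover_from_box:
  assumes fin: "\<forall>\<alpha>\<in>I. finite_index_subgroup G (\<sigma> \<alpha>)"
    and sep: "semi_conjugacy_separating G I \<sigma>"
    and inf: "infinite (carrier G)"
    and le: "asdim_le (box_set G I \<sigma>) (box_entourages G I \<sigma>) n"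
    and B: "finite B" "B \<subseteq> carrier G"
  obtains F where "finite F" "F \<subseteq> carrier G"
    and "\<And>T. finite T \<Longrightarrow> T \<subseteq> carrier G \<Longrightarrow>
      \<exists>\<V>. controlled_cover F B n T \<V>"
proof -
  let ?X = "box_set G I \<sigma>"
  have sub: "\<forall>\<alpha>\<in>I. subgroup (\<sigma> \<alpha>) G"
    using fin by (simp add: finite_index_subgroup_def)
  note act = box_act_closed[OF sub]
  let ?D = "\<Union>g\<in>B. box_Delta G I \<sigma> g"
  have "?D \<in> box_entourages G I \<sigma>"
    using sub B by (rule box_Delta_UN_entourage)
  then obtain \<U> where U: "(\<Union>U\<in>\<U>. U \<times> U) \<in> box_entourages G I \<sigma>"
    and mult: "\<And>\<W>. \<W> \<subseteq> \<U> \<Longrightarrow> card \<W> = n + 2 \<Longrightarrow> \<Inter>\<W> = {}"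
    and leb: "\<And>A. A \<subseteq> ?X \<Longrightarrow> A \<noteq> {} \<Longrightarrow> A \<times> A \<subseteq> ?D \<Longrightarrow> \<exists>U\<in>\<U>. A \<subseteq> U"
    using le unfolding asdim_le_def by meson
  obtain F K where F: "finite F" "F \<subseteq> carrier G" and K: "finite K" "K \<subseteq> ?X"
    and ctrl: "\<And>x y. (x, y) \<in> (\<Union>U\<in>\<U>. U \<times> U) \<Longrightarrow>
           x \<in> ?X \<and> (\<exists>g\<in>F. y = box_act G g x) \<or> x \<in> K \<and> y \<in> K"
    using box_entourage_controlled[OF sub U] by blast
  show thesis
  proof (rule that[OF F])
    fix T assume T: "finite T" "T \<subseteq> carrier G"
    \<comment> \<open>Chosen so that \<open>h x = f g x\<close> forces
      \<open>h = f \<otimes> g\<close>.\<close>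
    define S where "S = (\<lambda>(f, g, h). inv h \<otimes> (f \<otimes> g)) ` (F \<times> T \<times> T)"
    have S: "finite S" "S \<subseteq> carrier G" using F T by (auto simp: S_def)
    \<comment> \<open>The action preserves components, so the whole orbit of \<open>x\<close> misses
      \<open>K\<close> and two orbit points in one member are related by an element of
      \<open>F\<close>.\<close>
    obtain x where x: "x \<in> ?X" "fst x \<notin> fst ` K"
      and free: "\<And>g. g \<in> S \<Longrightarrow> box_act G g x = x \<Longrightarrow> g = \<one>"
      using free_point_exists[OF fin sep inf S, of "fst ` K"] K by blast
    define pull where "pull U = {g \<in> T. box_act G g x \<in> U}" for U
    show "\<exists>\<V>. controlled_cover F B n T \<V>"
      unfolding controlled_cover_def
    proof (intro exI[of _ "pull ` \<U>"] conjI ballI allI impI)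
      show "V \<subseteq> T" if "V \<in> pull ` \<U>" for V using that by (auto simp: pull_def)
    next
      fix V g h assume "V \<in> pull ` \<U>" "g \<in> V" "h \<in> V"
      then obtain U where Uu: "U \<in> \<U>" "box_act G g x \<in> U" "box_act G h x \<in> U"
        and gh: "g \<in> T" "h \<in> T" by (auto simp: pull_def)
      then have c: "g \<in> carrier G" "h \<in> carrier G" using T by auto
      have "box_act G g x \<notin> K" using x(2) by (metis box_act_def fst_conv imageI)
      then obtain f where f: "f \<in> F" "box_act G h x = box_act G f (box_act G g x)"
        using ctrl[of "box_act G g x" "box_act G h x"] Uu by blast
      have fc: "f \<in> carrier G" using f F by blast
      have "box_act G (inv h \<otimes> (f \<otimes> g)) x = box_act G (inv h) (box_act G h x)"
        using f(2) c fc x(1) by (simp add: box_act_mult[OF sub])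
      also have "\<dots> = x" using box_act_inv_cancel[OF sub x(1) c(2)] .
      finally have "inv h \<otimes> (f \<otimes> g) = \<one>"
        using f gh by (intro free) (force simp: S_def)+
      then have "h = f \<otimes> g" using c fc by (metis inv_equality inv_inv inv_closed m_closed)
      then show "h \<otimes> inv g \<in> F" using c fc f by (simp add: m_assoc)
    next
      fix \<W> assume W: "\<W> \<subseteq> pull ` \<U>" "card \<W> = n + 2"
      \<comment> \<open>Distinct members of \<open>\<U>\<close> may have equal preimages, so one
        representative is chosen for each preimage to keep the cardinality
        \<open>n + 2\<close>.\<close>
      then obtain \<W>' where W': "\<W>' \<subseteq> \<U>" "inj_on pull \<W>'" "\<W> = pull ` \<W>'"
        by (metis subset_image_inj)
      then have "\<Inter>\<W>' = {}" using mult W(2) by (simp add: card_image)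
      moreover have "box_act G g x \<in> \<Inter>\<W>'" if "g \<in> \<Inter>\<W>" for g
        using that W'(3) by (auto simp: pull_def)
      ultimately show "\<Inter>\<W> = {}" by blast
    next
      fix A assume A: "A \<subseteq> T" "A \<noteq> {} \<and> (\<forall>g\<in>A. \<forall>h\<in>A. h \<otimes> inv g \<in> B)"
      let ?A = "(\<lambda>g. box_act G g x) ` A"
      have "(box_act G g x, box_act G h x) \<in> ?D" if "g \<in> A" "h \<in> A" for g h
      proof -
        have c: "g \<in> carrier G" "h \<in> carrier G" using that A T by auto
        have "box_act G h x = box_act G (h \<otimes> inv g) (box_act G g x)"
          using c x(1) by (simp add: box_act_mult[OF sub] m_assoc)
        moreover have "h \<otimes> inv g \<in> B" "box_act G g x \<in> ?X" using A that act c x by auto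
        ultimately show ?thesis unfolding box_Delta_def by blast
      qed
      then have "?A \<times> ?A \<subseteq> ?D" by blast
      moreover have "?A \<subseteq> ?X" using A(1) T(2) act[OF x(1)] by blast
      moreover have "?A \<noteq> {}" using A by blast
      ultimately obtain U where "U \<in> \<U>" "?A \<subseteq> U" using leb by blast
      moreover from this have "A \<subseteq> pull U" using A(1) by (auto simp: pull_def)
      ultimately show "\<exists>V\<in>pull ` \<U>. A \<subseteq> V" by blast
    qed
  qed
qed

section \<open>From finite balls to the whole group\<close>

text \<open>Right invariance turns \<open>d g h\<close> into the distance from \<open>\<one>\<close>
  to \<open>h \<otimes> inv g\<close>, and properness makes balls finite. Hence a ball around
  \<open>\<one>\<close> can serve as \<open>B\<close>, and larger ones as the sets
  \<open>T\<close>.\<close>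

lemma asdim_le_from_box:
  assumes cnt: "countable (carrier G)"
    and proper: "proper_metric_on (carrier G) d"
    and rinv: "right_invariant_metric G d"
    and fin: "\<forall>\<alpha>\<in>I. finite_index_subgroup G (\<sigma> \<alpha>)"
    and sep: "semi_conjugacy_separating G I \<sigma>"
    and inf: "infinite (carrier G)"
    and le: "asdim_le (box_set G I \<sigma>) (box_entourages G I \<sigma>) n"
  shows "asdim_le (carrier G) (metric_entourages (carrier G) d) n"
  unfolding asdim_le_def
proof
  interpret Metric_space "carrier G" d
    using proper by (simp add: proper_metric_on_def)
  have ball: "finite (mcball \<one> r)" for r
    using proper by (simp add: proper_metric_on_def)
  have quot: "d \<one> (h \<otimes> inv g) = d g h" if "g \<in> carrier G" "h \<in> carrier G" for g h
  proof -
    have "d (g \<otimes> inv g) (h \<otimes> inv g) = d g h"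
      using rinv that inv_closed unfolding right_invariant_metric_def by blast
    then show ?thesis using that by simp
  qed
  fix E assume "E \<in> metric_entourages (carrier G) d"
  then obtain R0 where E: "\<And>x y. (x, y) \<in> E \<Longrightarrow> d x y \<le> R0"
    unfolding metric_entourages_def by blast
  \<comment> \<open>\<open>R0\<close> may be negative; with \<open>R\<close> non-negative,
    singletons satisfy \<open>P\<close>, which later shows that the limit family covers the
    group.\<close>
  define R where "R = max R0 0"
  obtain F where F: "finite F" "F \<subseteq> carrier G"
    and cov: "\<And>T. finite T \<Longrightarrow> T \<subseteq> carrier G \<Longrightarrow>
      \<exists>\<V>. controlled_cover F (mcball \<one> R) n T \<V>"
    using finite_set_cover_from_box[OF fin sep inf le ball[of R] mcball_subset_mspace] by blast
  have "\<forall>k::nat. \<exists>\<V>. controlled_cover F (mcball \<one> R) n (mcball \<one> k) \<V>"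
    by (intro allI cov[OF ball mcball_subset_mspace])
  from choice[OF this] obtain \<V> :: "nat \<Rightarrow> 'a set set"
    where cover: "controlled_cover F (mcball \<one> R) n (mcball \<one> (real k)) (\<V> k)" for k
    by blast
  have V: "\<And>k V. V \<in> \<V> k \<Longrightarrow> V \<subseteq> mcball \<one> (real k)"
      "\<And>k V g h. V \<in> \<V> k \<Longrightarrow> g \<in> V \<Longrightarrow> h \<in> V \<Longrightarrow> h \<otimes> inv g \<in> F"
    using cover[unfolded controlled_cover_def, THEN conjunct1] by blast+
  have mult: "\<Inter>\<W> = {}" if "\<W> \<subseteq> \<V> k" "card \<W> = n + 2" for k \<W>
    using cover[of k] that unfolding controlled_cover_def by simp
  have leb: "\<exists>V\<in>\<V> k. A \<subseteq> V"
    if "A \<subseteq> mcball \<one> (real k)" "A \<noteq> {}"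
      "\<And>g h. g \<in> A \<Longrightarrow> h \<in> A \<Longrightarrow> h \<otimes> inv g \<in> mcball \<one> R" for k A
    using cover[of k, unfolded controlled_cover_def, THEN conjunct2, THEN conjunct2] that by blast
  have Vc: "V \<subseteq> carrier G" if "V \<in> \<V> k" for V k
    using V(1)[OF that] by auto
  define P where "P A \<longleftrightarrow> A \<subseteq> carrier G \<and> A \<noteq> {} \<and> (\<forall>g\<in>A. \<forall>h\<in>A. d g h \<le> R)" for A
  obtain \<U> where U: "\<And>U. U \<in> \<U> \<Longrightarrow> \<exists>k. U \<in> \<V> k"
    and U_mult: "\<And>\<W>. \<W> \<subseteq> \<U> \<Longrightarrow> card \<W> = Suc (Suc n) \<Longrightarrow> \<Inter>\<W> = {}"
    and U_leb: "\<And>A. P A \<Longrightarrow> \<exists>U\<in>\<U>. A \<subseteq> U"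
  \<comment> \<open>A member containing \<open>g\<close> has displacements from \<open>g\<close> in
    \<open>F\<close>, so it lies in the finite right translate of \<open>F\<close> by
    \<open>g\<close>.\<close>
  proof (rule limit_cover_exists[OF cnt, where \<V> = \<V> and m = "Suc n" and P = P
        and N = "\<lambda>g. (\<lambda>f. f \<otimes> g) ` F"])
    show "V \<subseteq> carrier G" if "V \<in> \<V> k" for k V using Vc that .
    show "finite ((\<lambda>f. f \<otimes> g) ` F)" for g using F by simp
    show "V \<subseteq> (\<lambda>f. f \<otimes> g) ` F" if "V \<in> \<V> k" "g \<in> V" for k V g
    proof
      fix h assume "h \<in> V"
      then have "h \<otimes> inv g \<in> F" "h = h \<otimes> inv g \<otimes> g"
        using V(2)[OF that] Vc[OF that(1)] that(2) by (auto simp: m_assoc subset_iff)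
      then show "h \<in> (\<lambda>f. f \<otimes> g) ` F" by blast
    qed
    show "\<Inter>\<W> = {}" if "\<W> \<subseteq> \<V> k" "card \<W> = Suc (Suc n)" for k \<W>
      using mult that by simp
    fix A assume "P A"
    then have A: "A \<subseteq> carrier G" "A \<noteq> {}" and dA: "\<And>g h. g \<in> A \<Longrightarrow> h \<in> A \<Longrightarrow> d g h \<le> R"
      by (auto simp: P_def)
    then obtain a where a: "a \<in> A" by blast
    obtain k0 :: nat where k0: "d \<one> a + R \<le> k0" using real_arch_simple by blast
    have "\<exists>V\<in>\<V> k. A \<subseteq> V" if "k \<ge> k0" for k
    proof (rule leb[OF _ A(2)])
      show "A \<subseteq> mcball \<one> k"
      proof
        fix h assume h: "h \<in> A"
        have "d \<one> h \<le> d \<one> a + d a h" using a h A by (intro triangle) auto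
        also have "\<dots> \<le> k" using dA[OF a h] k0 that by linarith
        finally show "h \<in> mcball \<one> k" using h A by auto
      qed
      show "h \<otimes> inv g \<in> mcball \<one> R" if "g \<in> A" "h \<in> A" for g h
        using that A dA[OF that] quot[of g h] by (auto simp: subset_iff)
    qed
    then show "A \<noteq> {} \<and> (\<forall>\<^sub>F k in sequentially. \<exists>V\<in>\<V> k. A \<subseteq> V)"
      using A(2) by (auto simp: eventually_sequentially)
  qed (use that in blast)
  show "\<exists>\<U>. \<Union>\<U> = carrier G
        \<and> (\<Union>U\<in>\<U>. U \<times> U) \<in> metric_entourages (carrier G) d
        \<and> (\<forall>\<V>\<subseteq>\<U>. card \<V> = n + 2 \<longrightarrow> \<Inter>\<V> = {})
        \<and> (\<forall>A\<subseteq>carrier G. A \<noteq> {} \<and> A \<times> A \<subseteq> E \<longrightarrow> (\<exists>U\<in>\<U>. A \<subseteq> U))"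
  proof (intro exI[of _ \<U>] conjI allI impI)
    have Uc: "U \<subseteq> carrier G" if "U \<in> \<U>" for U using U[OF that] Vc by blast
    have "P {g}" if "g \<in> carrier G" for g using that by (auto simp: P_def R_def)
    then show "\<Union>\<U> = carrier G" using Uc U_leb by blast
    \<comment> \<open>For empty \<open>F\<close> this value is unspecified, but it is only compared
      with distances to elements of \<open>F\<close>.\<close>
    define S where "S = Max (d \<one> ` F)"
    have "d g h \<le> S" if gh: "U \<in> \<U>" "g \<in> U" "h \<in> U" for U g h
    proof -
      have c: "g \<in> carrier G" "h \<in> carrier G" using Uc[OF gh(1)] gh(2,3) by auto
      have "h \<otimes> inv g \<in> F" using U[OF gh(1)] V(2) gh(2,3) by blast
      then have "d \<one> (h \<otimes> inv g) \<le> S" unfolding S_def using F(1) by simp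
      then show ?thesis using quot[OF c] by simp
    qed
    then have "\<forall>(g, h)\<in>(\<Union>U\<in>\<U>. U \<times> U). d g h \<le> S" by blast
    then show "(\<Union>U\<in>\<U>. U \<times> U) \<in> metric_entourages (carrier G) d"
      using Uc unfolding metric_entourages_def by blast
    show "\<Inter>\<W> = {}" if "\<W> \<subseteq> \<U>" "card \<W> = n + 2" for \<W>
      using U_mult that by simp
    fix A assume A: "A \<subseteq> carrier G" "A \<noteq> {} \<and> A \<times> A \<subseteq> E"
    have "d g h \<le> R" if "g \<in> A" "h \<in> A" for g h
      using E[of g h] A that unfolding R_def by force
    then show "\<exists>U\<in>\<U>. A \<subseteq> U" using A by (intro U_leb) (auto simp: P_def)
  qed
qed

end

section \<open>Finite groups and the conclusion\<close>

text \<open>All of \<open>M\<close> is a single bounded member, and a one-element cover has no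
  subfamily of \<open>n + 2\<close> members.\<close>

lemma asdim_le_finite:
  assumes fin: "finite M"
  shows "asdim_le M (metric_entourages M d) n"
  unfolding asdim_le_def
proof (intro ballI exI[of _ "{M}"] conjI allI impI)
  have "\<forall>(x, y)\<in>M \<times> M. d x y \<le> Max ((\<lambda>(x, y). d x y) ` (M \<times> M))"
    using fin by (force intro!: Max_ge)
  then show "(\<Union>U\<in>{M}. U \<times> U) \<in> metric_entourages M d"
    unfolding metric_entourages_def by auto
  show "\<Inter>\<V> = {}" if "\<V> \<subseteq> {M}" "card \<V> = n + 2" for \<V>
    using card_mono[OF _ that(1)] that(2) by simp
qed auto

theorem proposition3p16:
  fixes G (structure)
    and d :: "'a \<Rightarrow> 'a \<Rightarrow> real"
    and I :: "'i set"
    and \<sigma> :: "'i \<Rightarrow> 'a set"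
  assumes "group G"
    and "countable (carrier G)"
    and "residually_finite G"
    and "proper_metric_on (carrier G) d"
    and "right_invariant_metric G d"
    and "\<And>\<alpha>. \<alpha> \<in> I \<Longrightarrow> finite_index_subgroup G (\<sigma> \<alpha>)"
    and "semi_conjugacy_separating G I \<sigma>"
  shows "asdim (carrier G) (metric_entourages (carrier G) d)
           \<le> asdim (box_set G I \<sigma>) (box_entourages G I \<sigma>)"
proof -
  have "asdim_le (carrier G) (metric_entourages (carrier G) d) n"
    if "asdim_le (box_set G I \<sigma>) (box_entourages G I \<sigma>) n" for n
  proof (cases "finite (carrier G)")
    case True
    then show ?thesis by (rule asdim_le_finite)
  next
    case False
    show ?thesis
      using group.asdim_le_from_box[OF assms(1,2,4,5) _ assms(7) False that] assms(6) by simp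
  qed
  \<comment> \<open>Every bound for the box space is one for \<open>G\<close>, so the infimum for
    \<open>G\<close> is over a larger set. Infinite dimension of the box space needs no separate
    case, as it is the infimum of the empty set.\<close>
  then show ?thesis
    unfolding asdim_def by (intro Inf_superset_mono) blast
qed

end
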